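(* Let $\mathfrak{d}$ be a semi-reduced divisor on $\mathcal{C}$ and let $(u,v)$ be its Mumford representation. Then $\widetilde{I(\mathfrak{d})} = \langle u,\, y-v\rangle$ as ideals of $\overline{K}[x,y]$, and $v^2-f\in\langle u\rangle$ in $\overline{K}[x]$. In particular, $\{u,\, y-v\}$ is the reduced Gröbner basis of $\widetilde{I(\mathfrak{d})}$ with respect to the monomial order $>_1$.
   Context: $K$ is a field with $\mathrm{char}(K)\neq 2$, $\overline{K}$ an algebraic closure, and $\mathcal{C}$ is the hyperelliptic curve over $K$ with affine equation $y^2=f(x)$, where $f\in K[x]$ is monic of degree $2g+1$ ($g\ge 1$) with no multiple roots in $\overline{K}$. $O$ is the unique point at infinity, $\mathcal{C}_{\mathrm{aff}}=\mathcal{C}\setminus\{O\}$, and $\iota:(x,y)\mapsto(x,-y)$ is the hyperelliptic involution. Curves and divisors are considered over $\overline{K}$. A semi-reduced divisor is an effective divisor $\mathfrak{d}=\sum_P e_PP$ supported in $\mathcal{C}_{\mathrm{aff}}$ such that $e_P=1$ if $e_P>0$ and $P=\iota(P)$, and $e_{\iota(P)}=0$ if $e_P>0$ and $P\ne\iota(P)$. $\overline{K}[\mathcal{C}]=\overline{K}[x,y]/\langle y^2-f\rangle$, and $[h]$ is the class of $h\in\overline{K}[x,y]$ in it. For a semi-reduced divisor $\mathfrak{d}=\sum_P e_PP$, $I(\mathfrak{d})=\{[h]\in\overline{K}[\mathcal{C}] : \mathrm{ord}_P([h])\ge e_P\ \forall P\in\mathrm{Supp}(\mathfrak{d})\}$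 and $\widetilde{I(\mathfrak{d})}=\{h\in\overline{K}[x,y] : [h]\in I(\mathfrak{d})\}$, where $\mathrm{ord}_P$ is the order function of the local ring of $\mathcal{C}$ at $P$. Mumford representation: for a non-zero semi-reduced divisor $\mathfrak{d}=\sum_{i=1}^r e_iP_i$ ($e_i>0$, $P_i=(x_i,y_i)$ distinct), it is the unique pair $(u,v)$ of polynomials in $\overline{K}[x]$ with $u=\prod_{i=1}^r(x-x_i)^{e_i}$, $\deg v<\deg u$, $\mathrm{ord}_{P_i}([y-v])\ge e_i$ for all $i$, and $u\mid v^2-f$. For $\mathfrak{d}=0$, the Mumford representation is taken to be $u=1$, $v=0$. $>_1$ is the pure lexicographic monomial order on $\overline{K}[x,y]$ with $y>x$.
   Formalization: For the zero divisor the convention u = 1, v = 0 gives {1, y}, which is a Gröbner basis of the unit ideal but not a reduced one; reducedness is therefore claimed only for non-zero semi-reduced divisors, everything else for all. *)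

theory Defs
  imports
    "HOL-Algebra.Ideal_Product"
    "HOL-Algebra.QuotRing"
    "HOL-Algebra.Algebraic_Closure_Type"
    "HOL-Library.Poly_Mapping"
    "HOL-Library.Extended_Nat"
begin

text \<open>
  The polynomial ring in x and y over a field is the type of polynomials in y whose coefficients
  are polynomials in x. Hence a polynomial p in x alone is [:p:], y - v is [:- v, 1:], and
  y^2 - f is [:- f, 0, 1:]. All rings are used as records of HOL-Algebra; a type class ring enters
  through ring_of_type_algebra.
\<close>

abbreviation x_ring :: "'a::field poly ring"
  where "x_ring \<equiv> ring_of_type_algebra"

abbreviation xy_ring :: "'a::field poly poly ring"
  where "xy_ring \<equiv> ring_of_type_algebra"

definition curve_ideal :: "'a::field poly \<Rightarrow> 'a poly poly set"
  where "curve_ideal f = Idl\<^bsub>xy_ring\<^esub> {[:- f, 0, 1:]}"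

definition coord_ring :: "'a::field poly \<Rightarrow> 'a poly poly set ring"
  where "coord_ring f = xy_ring Quot curve_ideal f"

definition coord_class :: "'a::field poly \<Rightarrow> 'a poly poly \<Rightarrow> 'a poly poly set"
  where "coord_class f h = curve_ideal f +>\<^bsub>xy_ring\<^esub> h"


subsection \<open>Points and divisors\<close>

text \<open>Since f has odd degree, the curve has exactly one point at infinity, called Infinity here
  (O in the usual notation). The coordinates of Infinity are unspecified and never used.\<close>

datatype 'a hpoint = Infinity | Affine (xcoord: 'a) (ycoord: 'a)

definition affine_points :: "'a::field poly \<Rightarrow> 'a hpoint set"
  where "affine_points f = {Affine a b |a b. b\<^sup>2 = poly f a}"

definition curve_points :: "'a::field poly \<Rightarrow> 'a hpoint set"
  where "curve_points f = insert Infinity (affine_points f)"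

fun hyp_inv :: "'a::field hpoint \<Rightarrow> 'a hpoint"
  where
    "hyp_inv Infinity = Infinity"
  | "hyp_inv (Affine a b) = Affine a (- b)"

definition is_divisor :: "'a::field poly \<Rightarrow> ('a hpoint \<Rightarrow>\<^sub>0 int) \<Rightarrow> bool"
  where "is_divisor f d \<longleftrightarrow> Poly_Mapping.keys d \<subseteq> curve_points f"

definition effective :: "('a hpoint \<Rightarrow>\<^sub>0 int) \<Rightarrow> bool"
  where "effective d \<longleftrightarrow> (\<forall>P. 0 \<le> Poly_Mapping.lookup d P)"

definition semi_reduced :: "'a::field poly \<Rightarrow> ('a hpoint \<Rightarrow>\<^sub>0 int) \<Rightarrow> bool"
  where "semi_reduced f d \<longleftrightarrow>
    is_divisor f d \<and> effective d \<and> Poly_Mapping.keys d \<subseteq> affine_points f \<and>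
    (\<forall>P. 0 < Poly_Mapping.lookup d P \<longrightarrow>
       (P = hyp_inv P \<longrightarrow> Poly_Mapping.lookup d P = 1) \<and>
       (P \<noteq> hyp_inv P \<longrightarrow> Poly_Mapping.lookup d (hyp_inv P) = 0))"


subsection \<open>Localization and the order function of a local ring\<close>

definition loc_rel ::
  "('a, 'm) ring_scheme \<Rightarrow> 'a set \<Rightarrow> (('a \<times> 'a) \<times> ('a \<times> 'a)) set"
  where "loc_rel R S = {((a, s), (b, t)).
     a \<in> carrier R \<and> s \<in> S \<and> b \<in> carrier R \<and> t \<in> S \<and>
     (\<exists>w\<in>S. w \<otimes>\<^bsub>R\<^esub> ((t \<otimes>\<^bsub>R\<^esub> a) \<ominus>\<^bsub>R\<^esub> (s \<otimes>\<^bsub>R\<^esub> b)) = \<zero>\<^bsub>R\<^esub>)}"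

text \<open>The fraction a/s.\<close>

definition loc_frac ::
  "('a, 'm) ring_scheme \<Rightarrow> 'a set \<Rightarrow> 'a \<Rightarrow> 'a \<Rightarrow> ('a \<times> 'a) set"
  where "loc_frac R S a s = loc_rel R S `` {(a, s)}"

definition localization ::
  "('a, 'm) ring_scheme \<Rightarrow> 'a set \<Rightarrow> ('a \<times> 'a) set ring"
  where "localization R S = \<lparr>
     carrier = (carrier R \<times> S) // loc_rel R S,
     monoid.mult = (\<lambda>A B. \<Union>(a, s)\<in>A. \<Union>(b, t)\<in>B.
        loc_frac R S (a \<otimes>\<^bsub>R\<^esub> b) (s \<otimes>\<^bsub>R\<^esub> t)),
     one = loc_frac R S \<one>\<^bsub>R\<^esub> \<one>\<^bsub>R\<^esub>,
     ring.zero = loc_frac R S \<zero>\<^bsub>R\<^esub> \<one>\<^bsub>R\<^esub>,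
     add = (\<lambda>A B. \<Union>(a, s)\<in>A. \<Union>(b, t)\<in>B.
        loc_frac R S ((t \<otimes>\<^bsub>R\<^esub> a) \<oplus>\<^bsub>R\<^esub> (s \<otimes>\<^bsub>R\<^esub> b)) (s \<otimes>\<^bsub>R\<^esub> t))\<rparr>"

text \<open>The maximal ideal of a local ring consists of the non-units.\<close>

definition max_ideal :: "('a, 'm) ring_scheme \<Rightarrow> 'a set"
  where "max_ideal R = carrier R - Units R"

text \<open>The order of z in a local ring with maximal ideal M is the largest n such that z lies in
  the n-th power of M; it is infinite if there is no largest one, as for z = 0.
  The power is taken in the semiring of ideals, so the 0-th power is the whole ring.\<close>

definition local_ord :: "('a, 'm) ring_scheme \<Rightarrow> 'a \<Rightarrow> enat"
  where "local_ord R z = Sup {enat n |n. z \<in> max_ideal R [^]\<^bsub>ideals_set R\<^esub> n}"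

definition eval_at :: "'a::field hpoint \<Rightarrow> 'a poly poly \<Rightarrow> 'a"
  where "eval_at P h = poly (poly h [:ycoord P:]) (xcoord P)"

text \<open>For an affine point P of the curve: the classes of the polynomials that do not vanish at P,
  the local ring at P, and the order at P of an element of the coordinate ring.\<close>

definition nonvanishing :: "'a::field poly \<Rightarrow> 'a hpoint \<Rightarrow> 'a poly poly set set"
  where "nonvanishing f P = {coord_class f h |h. eval_at P h \<noteq> 0}"

definition local_ring ::
  "'a::field poly \<Rightarrow> 'a hpoint \<Rightarrow> ('a poly poly set \<times> 'a poly poly set) set ring"
  where "local_ring f P = localization (coord_ring f) (nonvanishing f P)"

definition ord_at :: "'a::field poly \<Rightarrow> 'a hpoint \<Rightarrow> 'a poly poly set \<Rightarrow> enat"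
  where "ord_at f P c =
    local_ord (local_ring f P)
      (loc_frac (coord_ring f) (nonvanishing f P) c \<one>\<^bsub>coord_ring f\<^esub>)"


subsection \<open>The ideal of a divisor and the Mumford representation\<close>

definition div_ideal :: "'a::field poly \<Rightarrow> ('a hpoint \<Rightarrow>\<^sub>0 int) \<Rightarrow> 'a poly poly set set"
  where "div_ideal f d = {c \<in> carrier (coord_ring f).
     \<forall>P\<in>Poly_Mapping.keys d. enat (nat (Poly_Mapping.lookup d P)) \<le> ord_at f P c}"

definition div_ideal_lift :: "'a::field poly \<Rightarrow> ('a hpoint \<Rightarrow>\<^sub>0 int) \<Rightarrow> 'a poly poly set"
  where "div_ideal_lift f d = {h. coord_class f h \<in> div_ideal f d}"

definition mumford_rep ::
  "'a::field poly \<Rightarrow> ('a hpoint \<Rightarrow>\<^sub>0 int) \<Rightarrow> 'a poly \<Rightarrow> 'a poly \<Rightarrow> bool"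
  where "mumford_rep f d u v \<longleftrightarrow>
    (if d = 0 then u = 1 \<and> v = 0
     else
       u = (\<Prod>P\<in>Poly_Mapping.keys d. [:- xcoord P, 1:] ^ nat (Poly_Mapping.lookup d P)) \<and>
       Polynomial.degree v < Polynomial.degree u \<and>
       (\<forall>P\<in>Poly_Mapping.keys d.
          enat (nat (Poly_Mapping.lookup d P)) \<le> ord_at f P (coord_class f [:- v, 1:])) \<and>
       u dvd v\<^sup>2 - f)"


subsection \<open>Groebner bases in two variables\<close>

text \<open>The pair (i, j) stands for the monomial x^i y^j; a monomial order is given by its
  reflexive relation "less or equal".\<close>

type_synonym mono2 = "nat \<times> nat"

definition coeff2 :: "'a::field poly poly \<Rightarrow> mono2 \<Rightarrow> 'a"
  where "coeff2 p m = Polynomial.coeff (Polynomial.coeff p (snd m)) (fst m)"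

definition monom2 :: "'a::field \<Rightarrow> mono2 \<Rightarrow> 'a poly poly"
  where "monom2 c m = Polynomial.monom (Polynomial.monom c (fst m)) (snd m)"

definition monos2 :: "'a::field poly poly \<Rightarrow> mono2 set"
  where "monos2 p = {m. coeff2 p m \<noteq> 0}"

definition lex_y_gt_x :: "mono2 \<Rightarrow> mono2 \<Rightarrow> bool"
  where "lex_y_gt_x m m' \<longleftrightarrow> snd m < snd m' \<or> (snd m = snd m' \<and> fst m \<le> fst m')"

text \<open>The leading monomial, coefficient and term are meaningful for p other than 0 only.\<close>

definition lead_mono :: "(mono2 \<Rightarrow> mono2 \<Rightarrow> bool) \<Rightarrow> 'a::field poly poly \<Rightarrow> mono2"
  where "lead_mono mo p = (THE m. m \<in> monos2 p \<and> (\<forall>m'\<in>monos2 p. mo m' m))"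

definition lead_coeff2 :: "(mono2 \<Rightarrow> mono2 \<Rightarrow> bool) \<Rightarrow> 'a::field poly poly \<Rightarrow> 'a"
  where "lead_coeff2 mo p = coeff2 p (lead_mono mo p)"

definition lead_term :: "(mono2 \<Rightarrow> mono2 \<Rightarrow> bool) \<Rightarrow> 'a::field poly poly \<Rightarrow> 'a poly poly"
  where "lead_term mo p = monom2 (lead_coeff2 mo p) (lead_mono mo p)"

definition groebner_basis ::
  "(mono2 \<Rightarrow> mono2 \<Rightarrow> bool) \<Rightarrow> 'a::field poly poly set \<Rightarrow> 'a poly poly set \<Rightarrow> bool"
  where "groebner_basis mo I G \<longleftrightarrow>
    ideal I xy_ring \<and> finite G \<and> G \<subseteq> I \<and> 0 \<notin> G \<and>
    Idl\<^bsub>xy_ring\<^esub> (lead_term mo ` G) = Idl\<^bsub>xy_ring\<^esub> (lead_term mo ` (I - {0}))"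

definition reduced_groebner_basis ::
  "(mono2 \<Rightarrow> mono2 \<Rightarrow> bool) \<Rightarrow> 'a::field poly poly set \<Rightarrow> 'a poly poly set \<Rightarrow> bool"
  where "reduced_groebner_basis mo I G \<longleftrightarrow>
    groebner_basis mo I G \<and>
    (\<forall>p\<in>G. lead_coeff2 mo p = 1 \<and>
       (\<forall>m\<in>monos2 p. monom2 1 m \<notin> Idl\<^bsub>xy_ring\<^esub> (lead_term mo ` (G - {p}))))"

end

theory Submission
  imports Defs
begin

text \<open>
  For h = q (y - v) + h(x, v) only the remainder h(x, v) matters, so \<open>\<langle>u, y - v\<rangle>\<close> consists of
  the h with u dividing h(x, v). At a point P = (a, b) of multiplicity e we have v(a) = b, and since
  \<open>(x - a)\<^sup>e\<close> divides \<open>v\<^sup>2 - f\<close>, substituting v for y is a ring homomorphism from the coordinate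
  ring to \<open>K[x] / (x - a)\<^sup>e\<close>. It maps everything that does not vanish at P to a unit and the n-th power
  of the maximal ideal at P into the ideal of \<open>(x - a)\<^sup>n\<close>; hence order at least e at P forces
  \<open>(x - a)\<^sup>e\<close> to divide h(x, v). Semi-reducedness makes the x-coordinates in the support
  distinct, so the prime power factors combine to u.
\<close>

section \<open>Localization\<close>

text \<open>\<open>S\<close> may contain zero divisors, so equality of fractions is tested only up
  to a factor from \<open>S\<close>. The coordinate ring can thus be localized without first being
  shown to be a domain.\<close>

locale multiplicative_subset = cring R for R (structure) +
  fixes S
  assumes S_carrier: "S \<subseteq> carrier R"
    and one_S: "\<one> \<in> S"
    and mult_S: "\<lbrakk>s \<in> S; t \<in> S\<rbrakk> \<Longrightarrow> s \<otimes> t \<in> S"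
begin

lemma S_closed [simp, intro]: "s \<in> S \<Longrightarrow> s \<in> carrier R"
  using S_carrier by blast

lemma loc_rel_iff:
  assumes "a \<in> carrier R" "b \<in> carrier R" "s \<in> S" "t \<in> S"
  shows "((a, s), (b, t)) \<in> loc_rel R S \<longleftrightarrow> (\<exists>w\<in>S. w \<otimes> (t \<otimes> a \<ominus> s \<otimes> b) = \<zero>)"
  using assms by (auto simp: loc_rel_def)

lemma loc_relE:
  assumes "((a, s), (b, t)) \<in> loc_rel R S"
  obtains w where "w \<in> S" "w \<otimes> (t \<otimes> a \<ominus> s \<otimes> b) = \<zero>"
    "a \<in> carrier R" "b \<in> carrier R" "s \<in> S" "t \<in> S"
  using assms by (auto simp: loc_rel_def)

lemma equiv_loc_rel: "equiv (carrier R \<times> S) (loc_rel R S)"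
proof (rule equivI)
  show "loc_rel R S \<subseteq> (carrier R \<times> S) \<times> (carrier R \<times> S)"
    by (auto simp: loc_rel_def)
  show "refl_on (carrier R \<times> S) (loc_rel R S)"
  proof (rule refl_onI, clarify)
    fix a s assume "a \<in> carrier R" "s \<in> S"
    then have "\<one> \<otimes> (s \<otimes> a \<ominus> s \<otimes> a) = \<zero>" by (auto simp: r_neg a_minus_def)
    with \<open>a \<in> carrier R\<close> \<open>s \<in> S\<close> show "((a, s), (a, s)) \<in> loc_rel R S"
      by (subst loc_rel_iff) (use one_S in \<open>blast+\<close>)
  qed
  show "sym (loc_rel R S)"
  proof (rule symI, clarify)
    fix a s b t assume "((a, s), (b, t)) \<in> loc_rel R S"
    then obtain w where w: "w \<in> S" "w \<otimes> (t \<otimes> a \<ominus> s \<otimes> b) = \<zero>"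
      "a \<in> carrier R" "b \<in> carrier R" "s \<in> S" "t \<in> S" by (rule loc_relE)
    then have c: "w \<in> carrier R" "s \<in> carrier R" "t \<in> carrier R" by auto
    have "w \<otimes> (s \<otimes> b \<ominus> t \<otimes> a) = \<ominus> (w \<otimes> (t \<otimes> a \<ominus> s \<otimes> b))"
      using c w(3,4) by algebra
    with w show "((b, t), (a, s)) \<in> loc_rel R S" by (auto simp: loc_rel_iff)
  qed
  show "trans (loc_rel R S)"
  proof (rule transI, clarify)
    fix a s b t c r
    assume "((a, s), (b, t)) \<in> loc_rel R S" "((b, t), (c, r)) \<in> loc_rel R S"
    then obtain w z where w: "w \<in> S" "w \<otimes> (t \<otimes> a \<ominus> s \<otimes> b) = \<zero>"
      "z \<in> S" "z \<otimes> (r \<otimes> b \<ominus> t \<otimes> c) = \<zero>"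
      "a \<in> carrier R" "b \<in> carrier R" "c \<in> carrier R" "s \<in> S" "t \<in> S" "r \<in> S"
      by (elim loc_relE) blast
    then have cl: "w \<in> carrier R" "z \<in> carrier R" "s \<in> carrier R" "t \<in> carrier R" "r \<in> carrier R"
      by auto
    \<comment> \<open>Transitivity eliminates \<open>b\<close> between the two relations. The middle
      denominator \<open>t\<close> cannot be cancelled, so it joins \<open>w\<close> and
      \<open>z\<close> in the witness.\<close>
    have "w \<otimes> z \<otimes> t \<otimes> (r \<otimes> a \<ominus> s \<otimes> c)
        = z \<otimes> r \<otimes> (w \<otimes> (t \<otimes> a \<ominus> s \<otimes> b)) \<oplus> w \<otimes> s \<otimes> (z \<otimes> (r \<otimes> b \<ominus> t \<otimes> c))"
      using cl w(5-7) by algebra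
    with w cl have "w \<otimes> z \<otimes> t \<otimes> (r \<otimes> a \<ominus> s \<otimes> c) = \<zero>" by simp
    moreover have "w \<otimes> z \<otimes> t \<in> S" using w by (simp add: mult_S)
    ultimately show "((a, s), (c, r)) \<in> loc_rel R S" using w by (auto simp: loc_rel_iff)
  qed
qed

lemma loc_frac_eq_iff:
  assumes "a \<in> carrier R" "b \<in> carrier R" "s \<in> S" "t \<in> S"
  shows "loc_frac R S a s = loc_frac R S b t \<longleftrightarrow> (\<exists>w\<in>S. w \<otimes> (t \<otimes> a \<ominus> s \<otimes> b) = \<zero>)"
  unfolding loc_frac_def using eq_equiv_class_iff[OF equiv_loc_rel] assms
  by (simp add: loc_rel_iff)

lemma loc_frac_eqI:
  assumes "a \<in> carrier R" "b \<in> carrier R" "s \<in> S" "t \<in> S" "t \<otimes> a = s \<otimes> b"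
  shows "loc_frac R S a s = loc_frac R S b t"
proof -
  have "\<one> \<otimes> (t \<otimes> a \<ominus> s \<otimes> b) = \<zero>"
    using assms by (simp add: a_minus_def r_neg)
  then show ?thesis
    using one_S assms(1-4) loc_frac_eq_iff by blast
qed

lemma loc_frac_memI:
  assumes "a \<in> carrier R" "s \<in> S"
  shows "(a, s) \<in> loc_frac R S a s"
  unfolding loc_frac_def using equiv_class_self[OF equiv_loc_rel] assms by simp

lemma loc_frac_memD:
  assumes "(b, t) \<in> loc_frac R S a s"
  shows "((a, s), (b, t)) \<in> loc_rel R S"
  using assms by (simp add: loc_frac_def)

lemma carrier_localization:
  "carrier (localization R S) = {loc_frac R S a s |a s. a \<in> carrier R \<and> s \<in> S}"
  by (auto simp: localization_def quotient_def loc_frac_def)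

lemma loc_frac_carrier [simp]:
  "\<lbrakk>a \<in> carrier R; s \<in> S\<rbrakk> \<Longrightarrow> loc_frac R S a s \<in> carrier (localization R S)"
  by (auto simp: carrier_localization)

text \<open>The operations of \<open>localization\<close> are unions over all pairs of
  representatives. Once the resulting class does not depend on the representatives, the union is
  that single class.\<close>

lemma UN_loc_frac_const:
  assumes "a \<in> carrier R" "b \<in> carrier R" "s \<in> S" "t \<in> S"
    and "\<And>a' s' b' t'. \<lbrakk>((a, s), (a', s')) \<in> loc_rel R S; ((b, t), (b', t')) \<in> loc_rel R S\<rbrakk>
           \<Longrightarrow> h a' s' b' t' = h a s b t"
  shows "(\<Union>(a', s')\<in>loc_frac R S a s. \<Union>(b', t')\<in>loc_frac R S b t. h a' s' b' t') = h a s b t"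
proof -
  have "h a' s' b' t' = h a s b t"
    if "(a', s') \<in> loc_frac R S a s" "(b', t') \<in> loc_frac R S b t" for a' s' b' t'
    using that assms(5) by (blast dest: loc_frac_memD)
  then have "(\<Union>(a', s')\<in>loc_frac R S a s. \<Union>(b', t')\<in>loc_frac R S b t. h a' s' b' t')
      = (\<Union>p\<in>loc_frac R S a s. \<Union>q\<in>loc_frac R S b t. h a s b t)"
    by (intro SUP_cong) auto
  also have "\<dots> = h a s b t"
    using loc_frac_memI assms(1-4) by blast
  finally show ?thesis .
qed

lemma mult_loc_frac:
  assumes "a \<in> carrier R" "b \<in> carrier R" "s \<in> S" "t \<in> S"
  shows "loc_frac R S a s \<otimes>\<^bsub>localization R S\<^esub> loc_frac R S b t = loc_frac R S (a \<otimes> b) (s \<otimes> t)"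
  unfolding localization_def monoid.simps
proof (rule UN_loc_frac_const[OF assms])
  fix a' s' b' t'
  assume "((a, s), (a', s')) \<in> loc_rel R S" "((b, t), (b', t')) \<in> loc_rel R S"
  then obtain w z where w: "w \<in> S" "w \<otimes> (s' \<otimes> a \<ominus> s \<otimes> a') = \<zero>" "a' \<in> carrier R" "s' \<in> S"
    and z: "z \<in> S" "z \<otimes> (t' \<otimes> b \<ominus> t \<otimes> b') = \<zero>" "b' \<in> carrier R" "t' \<in> S"
    by (elim loc_relE) blast
  then have cl: "w \<in> carrier R" "z \<in> carrier R" "s \<in> carrier R" "t \<in> carrier R"
      "s' \<in> carrier R" "t' \<in> carrier R"
    using assms by auto
  \<comment> \<open>The difference telescopes through the mixed term with \<open>a'\<close> and
    \<open>b\<close>, which exchanges one representative at a time.\<close>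
  have "w \<otimes> z \<otimes> (s \<otimes> t \<otimes> (a' \<otimes> b') \<ominus> s' \<otimes> t' \<otimes> (a \<otimes> b))
      = \<ominus> (z \<otimes> t' \<otimes> b \<otimes> (w \<otimes> (s' \<otimes> a \<ominus> s \<otimes> a'))
           \<oplus> w \<otimes> s \<otimes> a' \<otimes> (z \<otimes> (t' \<otimes> b \<ominus> t \<otimes> b')))"
    using cl w(3) z(3) assms(1,2) by algebra
  also have "\<dots> = \<zero>" using w z cl assms by simp
  finally show "loc_frac R S (a' \<otimes> b') (s' \<otimes> t') = loc_frac R S (a \<otimes> b) (s \<otimes> t)"
    using w z assms mult_S by (subst loc_frac_eq_iff) auto
qed

lemma add_loc_frac:
  assumes "a \<in> carrier R" "b \<in> carrier R" "s \<in> S" "t \<in> S"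
  shows "loc_frac R S a s \<oplus>\<^bsub>localization R S\<^esub> loc_frac R S b t
    = loc_frac R S (t \<otimes> a \<oplus> s \<otimes> b) (s \<otimes> t)"
  unfolding localization_def ring.simps
proof (rule UN_loc_frac_const[OF assms])
  fix a' s' b' t'
  assume "((a, s), (a', s')) \<in> loc_rel R S" "((b, t), (b', t')) \<in> loc_rel R S"
  then obtain w z where w: "w \<in> S" "w \<otimes> (s' \<otimes> a \<ominus> s \<otimes> a') = \<zero>" "a' \<in> carrier R" "s' \<in> S"
    and z: "z \<in> S" "z \<otimes> (t' \<otimes> b \<ominus> t \<otimes> b') = \<zero>" "b' \<in> carrier R" "t' \<in> S"
    by (elim loc_relE) blast
  then have cl: "w \<in> carrier R" "z \<in> carrier R" "s \<in> carrier R" "t \<in> carrier R"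
      "s' \<in> carrier R" "t' \<in> carrier R"
    using assms by auto
  have "w \<otimes> z \<otimes> (s \<otimes> t \<otimes> (t' \<otimes> a' \<oplus> s' \<otimes> b') \<ominus> s' \<otimes> t' \<otimes> (t \<otimes> a \<oplus> s \<otimes> b))
      = \<ominus> (z \<otimes> t \<otimes> t' \<otimes> (w \<otimes> (s' \<otimes> a \<ominus> s \<otimes> a'))
           \<oplus> w \<otimes> s \<otimes> s' \<otimes> (z \<otimes> (t' \<otimes> b \<ominus> t \<otimes> b')))"
    using cl w(3) z(3) assms(1,2) by algebra
  also have "\<dots> = \<zero>" using w z cl assms by simp
  finally show "loc_frac R S (t' \<otimes> a' \<oplus> s' \<otimes> b') (s' \<otimes> t')
      = loc_frac R S (t \<otimes> a \<oplus> s \<otimes> b) (s \<otimes> t)"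
    using w z cl assms mult_S by (subst loc_frac_eq_iff) auto
qed

lemma one_localization: "\<one>\<^bsub>localization R S\<^esub> = loc_frac R S \<one> \<one>"
  and zero_localization: "\<zero>\<^bsub>localization R S\<^esub> = loc_frac R S \<zero> \<one>"
  by (simp_all add: localization_def)

text \<open>By the formulas for sums and products, each equational axiom compares two explicit
  fractions, and cross multiplication leaves an identity in the commutative ring
  \<open>R\<close>.\<close>

lemma localization_cring: "cring (localization R S)"
proof -
  note simps = carrier_localization add_loc_frac mult_loc_frac one_localization zero_localization
    one_S mult_S
  show ?thesis
  proof (rule cringI)
    show "abelian_group (localization R S)"
    proof (rule abelian_groupI, goal_cases)
      case (1 x y) then show ?case by (auto simp: simps) (blast intro: mult_S a_closed m_closed)
    next
      case 2 then show ?case using one_S by (simp add: zero_localization)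
    next
      case (3 x y z)
      then show ?case
        by (clarsimp simp: simps)
          (rule loc_frac_eqI, (auto simp: mult_S one_S)[4], (drule S_closed)+, algebra)
    next
      case (4 x y)
      then show ?case
        by (clarsimp simp: simps)
          (rule loc_frac_eqI, (auto simp: mult_S one_S)[4], (drule S_closed)+, algebra)
    next
      case (5 x)
      then show ?case by (clarsimp simp: simps)
    next
      case (6 x)
      then obtain a s where as: "a \<in> carrier R" "s \<in> S" "x = loc_frac R S a s"
        by (auto simp: carrier_localization)
      have "loc_frac R S (\<ominus> a) s \<oplus>\<^bsub>localization R S\<^esub> x = \<zero>\<^bsub>localization R S\<^esub>"
        using as by (simp add: simps r_minus l_neg)
          (rule loc_frac_eqI, auto simp: mult_S one_S)
      then show ?case using as by (blast intro: loc_frac_carrier a_inv_closed)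
    qed
    show "comm_monoid (localization R S)"
    proof (rule comm_monoidI, goal_cases)
      case (1 x y) then show ?case by (auto simp: simps) (blast intro: mult_S m_closed)
    next
      case 2 then show ?case using one_S by (simp add: one_localization)
    next
      case (3 x y z)
      then show ?case
        by (clarsimp simp: simps)
          (rule loc_frac_eqI, (auto simp: mult_S one_S)[4], (drule S_closed)+, algebra)
    next
      case (4 x)
      then show ?case by (clarsimp simp: simps)
    next
      case (5 x y)
      then show ?case
        by (clarsimp simp: simps)
          (rule loc_frac_eqI, (auto simp: mult_S one_S)[4], (drule S_closed)+, algebra)
    qed
  next
    fix x y z
    assume "x \<in> carrier (localization R S)" "y \<in> carrier (localization R S)"
      "z \<in> carrier (localization R S)"
    then show "(x \<oplus>\<^bsub>localization R S\<^esub> y) \<otimes>\<^bsub>localization R S\<^esub> z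
        = x \<otimes>\<^bsub>localization R S\<^esub> z \<oplus>\<^bsub>localization R S\<^esub> y \<otimes>\<^bsub>localization R S\<^esub> z"
      by (clarsimp simp: simps)
        (rule loc_frac_eqI, (auto simp: mult_S one_S)[4], (drule S_closed)+, algebra)
  qed
qed

end


section \<open>The local ring at an affine point\<close>

lemma ring_of_type_algebra_simps [simp]:
  "carrier ring_of_type_algebra = UNIV"
  "x \<otimes>\<^bsub>ring_of_type_algebra\<^esub> y = x * y"
  "x \<oplus>\<^bsub>ring_of_type_algebra\<^esub> y = x + y"
  "\<one>\<^bsub>ring_of_type_algebra\<^esub> = 1"
  "\<zero>\<^bsub>ring_of_type_algebra\<^esub> = 0"
  for x y :: "'a::ring_1"
  by (simp_all add: ring_of_type_algebra_def)

lemma a_inv_ring_of_type_algebra [simp]: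
  "\<ominus>\<^bsub>ring_of_type_algebra\<^esub> x = - x" for x :: "'a::comm_ring_1"
proof -
  interpret cring "ring_of_type_algebra :: 'a ring" by (rule cring_from_type_algebra)
  show ?thesis by (rule minus_equality) simp_all
qed

text \<open>No clause for negatives appears, because - x is the multiple of x by - 1.\<close>

lemma ideal_ring_of_type_algebra_iff:
  fixes I :: "'a::comm_ring_1 set"
  shows "ideal I ring_of_type_algebra \<longleftrightarrow>
    0 \<in> I \<and> (\<forall>x\<in>I. \<forall>y\<in>I. x + y \<in> I) \<and> (\<forall>x\<in>I. \<forall>r. r * x \<in> I)" (is "_ \<longleftrightarrow> ?rhs")
proof
  interpret cring "ring_of_type_algebra :: 'a ring" by (rule cring_from_type_algebra)
  show "ideal I ring_of_type_algebra" if *: ?rhs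
  proof (rule idealI)
    have "- x \<in> I" if "x \<in> I" for x
      using * that by (metis mult_minus1)
    then show "subgroup I (add_monoid (ring_of_type_algebra :: 'a ring))"
      using * by (intro add.subgroupI) auto
  qed (use * in \<open>auto simp: mult.commute ring_axioms\<close>)
  show ?rhs if "ideal I ring_of_type_algebra"
  proof -
    interpret I: ideal I "ring_of_type_algebra :: 'a ring" by fact
    show ?thesis
      using I.zero_closed I.a_closed I.I_l_closed by simp
  qed
qed

lemma Idl_singleton:
  "Idl\<^bsub>ring_of_type_algebra\<^esub> {p} = {q. p dvd q}" for p :: "'a::comm_ring_1"
proof -
  interpret cring "ring_of_type_algebra :: 'a ring" by (rule cring_from_type_algebra)
  show ?thesis
    by (auto simp: cgenideal_eq_genideal[symmetric] cgenideal_def dvd_def mult.commute)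
qed

section \<open>The coordinate ring\<close>

lemma coord_ring_hom: "ring_hom_cring xy_ring (coord_ring f) (coord_class f)"
proof -
  interpret cring "xy_ring :: 'a poly poly ring" by (rule cring_from_type_algebra)
  interpret ideal "curve_ideal f" xy_ring
    unfolding curve_ideal_def by (rule genideal_ideal) simp
  show ?thesis
    unfolding coord_ring_def coord_class_def by (rule rcos_ring_hom_cring) (rule is_cring)
qed

lemma coord_class_eq_iff:
  "coord_class f h = coord_class f k \<longleftrightarrow> [:- f, 0, 1:] dvd h - k"
proof -
  interpret cring "xy_ring :: 'a poly poly ring" by (rule cring_from_type_algebra)
  interpret ideal "curve_ideal f" xy_ring
    unfolding curve_ideal_def by (rule genideal_ideal) simp
  show ?thesis
    using quotient_eq_iff_same_a_r_cos[OF ideal_axioms, of h k]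
    by (simp add: coord_class_def curve_ideal_def Idl_singleton a_minus_def)
qed

lemma coord_class_carrier [simp]: "coord_class f h \<in> carrier (coord_ring f)"
proof -
  interpret ring_hom_cring xy_ring "coord_ring f" "coord_class f" by (rule coord_ring_hom)
  show ?thesis by simp
qed

lemma carrier_coord_ring: "carrier (coord_ring f) = range (coord_class f)"
  by (auto simp: coord_ring_def FactRing_def A_RCOSETS_def' coord_class_def)

lemma coord_class_simps:
  "coord_class f h \<otimes>\<^bsub>coord_ring f\<^esub> coord_class f k = coord_class f (h * k)"
  "coord_class f h \<oplus>\<^bsub>coord_ring f\<^esub> coord_class f k = coord_class f (h + k)"
  "coord_class f h \<ominus>\<^bsub>coord_ring f\<^esub> coord_class f k = coord_class f (h - k)"
  "\<one>\<^bsub>coord_ring f\<^esub> = coord_class f 1"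
  "\<zero>\<^bsub>coord_ring f\<^esub> = coord_class f 0"
proof -
  interpret ring_hom_cring xy_ring "coord_ring f" "coord_class f" by (rule coord_ring_hom)
  show "coord_class f h \<otimes>\<^bsub>coord_ring f\<^esub> coord_class f k = coord_class f (h * k)"
    "coord_class f h \<oplus>\<^bsub>coord_ring f\<^esub> coord_class f k = coord_class f (h + k)"
    "\<one>\<^bsub>coord_ring f\<^esub> = coord_class f 1" "\<zero>\<^bsub>coord_ring f\<^esub> = coord_class f 0"
    using hom_mult[of h k] hom_add[of h k] hom_one hom_zero by simp_all
  show "coord_class f h \<ominus>\<^bsub>coord_ring f\<^esub> coord_class f k = coord_class f (h - k)"
    using hom_add[of h "- k"] hom_a_inv[of k] by (simp add: a_minus_def)
qed

section \<open>Evaluation at a point\<close>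

lemma eval_at_simps [simp]:
  "eval_at P 0 = 0" "eval_at P 1 = 1"
  "eval_at P (h + k) = eval_at P h + eval_at P k"
  "eval_at P (- h) = - eval_at P h"
  "eval_at P (h - k) = eval_at P h - eval_at P k"
  "eval_at P (h * k) = eval_at P h * eval_at P k"
  by (simp_all add: eval_at_def)

text \<open>At a point (a, b) of the curve, y^2 - f takes the value b^2 - f(a) = 0. Hence the value
  of a polynomial at \<open>P\<close> depends only on its class.\<close>

lemma eval_at_curve_dvd:
  assumes "P \<in> affine_points f" "[:- f, 0, 1:] dvd h"
  shows "eval_at P h = 0"
  using assms by (auto simp: affine_points_def eval_at_def dvd_def power2_eq_square)

lemma multiplicative_subset_nonvanishing:
  assumes "P \<in> affine_points f"
  shows "multiplicative_subset (coord_ring f) (nonvanishing f P)"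
proof -
  interpret ring_hom_cring xy_ring "coord_ring f" "coord_class f" by (rule coord_ring_hom)
  show ?thesis
  proof
    show "nonvanishing f P \<subseteq> carrier (coord_ring f)"
      by (auto simp: nonvanishing_def)
    show "\<one>\<^bsub>coord_ring f\<^esub> \<in> nonvanishing f P"
      by (auto simp: nonvanishing_def coord_class_simps intro!: exI[of _ 1])
    fix s t assume "s \<in> nonvanishing f P" "t \<in> nonvanishing f P"
    then obtain h k where "s = coord_class f h" "t = coord_class f k"
      "eval_at P h \<noteq> 0" "eval_at P k \<noteq> 0"
      by (auto simp: nonvanishing_def)
    then show "s \<otimes>\<^bsub>coord_ring f\<^esub> t \<in> nonvanishing f P"
      by (auto simp: nonvanishing_def coord_class_simps intro!: exI[of _ "h * k"])
  qed
qed

text \<open>Numerator and denominator are polynomials instead of classes, so that computations in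
  the local ring take place in K[x,y].\<close>

definition curve_frac :: "'a::field poly \<Rightarrow> 'a hpoint \<Rightarrow> 'a poly poly \<Rightarrow> 'a poly poly
    \<Rightarrow> ('a poly poly set \<times> 'a poly poly set) set"
  where "curve_frac f P h s
    = loc_frac (coord_ring f) (nonvanishing f P) (coord_class f h) (coord_class f s)"

lemma coord_class_nonvanishing: "eval_at P s \<noteq> 0 \<Longrightarrow> coord_class f s \<in> nonvanishing f P"
  by (auto simp: nonvanishing_def)

context
  fixes f :: "'a::field poly" and P :: "'a hpoint"
  assumes P: "P \<in> affine_points f"
begin

interpretation loc: multiplicative_subset "coord_ring f" "nonvanishing f P"
  using P by (rule multiplicative_subset_nonvanishing)

lemma local_ring_cring: "cring (local_ring f P)"
  unfolding local_ring_def by (rule loc.localization_cring)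

interpretation L: cring "local_ring f P" by (rule local_ring_cring)

lemma carrier_local_ring:
  "carrier (local_ring f P) = {curve_frac f P h s |h s. eval_at P s \<noteq> 0}"
  unfolding local_ring_def loc.carrier_localization carrier_coord_ring curve_frac_def
  by (auto simp: nonvanishing_def)

text \<open>This removes both quotient constructions at once: from here on, equality in the local
  ring is a divisibility by y^2 - f.\<close>

lemma curve_frac_eq_iff:
  assumes "eval_at P s \<noteq> 0" "eval_at P t \<noteq> 0"
  shows "curve_frac f P h s = curve_frac f P k t \<longleftrightarrow>
    (\<exists>w. eval_at P w \<noteq> 0 \<and> [:- f, 0, 1:] dvd w * (t * h - s * k))"
proof -
  have "curve_frac f P h s = curve_frac f P k t \<longleftrightarrow>
    (\<exists>w\<in>nonvanishing f P. w \<otimes>\<^bsub>coord_ring f\<^esub> coord_class f (t * h - s * k) = coord_class f 0)"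
    unfolding curve_frac_def using assms
    by (subst loc.loc_frac_eq_iff) (auto simp: coord_class_nonvanishing coord_class_simps)
  also have "\<dots> \<longleftrightarrow> (\<exists>w. eval_at P w \<noteq> 0 \<and>
      coord_class f w \<otimes>\<^bsub>coord_ring f\<^esub> coord_class f (t * h - s * k) = coord_class f 0)"
    by (auto simp: nonvanishing_def)
  also have "\<dots> \<longleftrightarrow> (\<exists>w. eval_at P w \<noteq> 0 \<and> [:- f, 0, 1:] dvd w * (t * h - s * k))"
    by (simp add: coord_class_simps coord_class_eq_iff)
  finally show ?thesis .
qed

lemma curve_frac_simps:
  assumes "eval_at P s \<noteq> 0" "eval_at P t \<noteq> 0"
  shows "curve_frac f P h s \<otimes>\<^bsub>local_ring f P\<^esub> curve_frac f P k t = curve_frac f P (h * k) (s * t)"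
    and "curve_frac f P h s \<oplus>\<^bsub>local_ring f P\<^esub> curve_frac f P k t
      = curve_frac f P (t * h + s * k) (s * t)"
  using assms unfolding curve_frac_def local_ring_def
  by (simp_all add: loc.mult_loc_frac loc.add_loc_frac coord_class_nonvanishing coord_class_simps)

lemma one_local_ring: "\<one>\<^bsub>local_ring f P\<^esub> = curve_frac f P 1 1"
  and zero_local_ring: "\<zero>\<^bsub>local_ring f P\<^esub> = curve_frac f P 0 1"
  unfolding curve_frac_def local_ring_def
  by (simp_all add: loc.one_localization loc.zero_localization coord_class_simps)

text \<open>If k/t is inverse to h/s, then evaluating the cross-multiplied equation at
  \<open>P\<close> gives h(P) k(P) = s(P) t(P), which is non-zero. Conversely s/h is the
  inverse.\<close>

lemma curve_frac_in_Units_iff: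
  assumes s: "eval_at P s \<noteq> 0"
  shows "curve_frac f P h s \<in> Units (local_ring f P) \<longleftrightarrow> eval_at P h \<noteq> 0"
proof
  assume "curve_frac f P h s \<in> Units (local_ring f P)"
  then obtain y where "y \<in> carrier (local_ring f P)"
    "curve_frac f P h s \<otimes>\<^bsub>local_ring f P\<^esub> y = \<one>\<^bsub>local_ring f P\<^esub>"
    by (auto simp: Units_def)
  then obtain k t where t: "eval_at P t \<noteq> 0"
    and "curve_frac f P (h * k) (s * t) = curve_frac f P 1 1"
    using s by (auto simp: carrier_local_ring curve_frac_simps one_local_ring)
  then obtain w where "eval_at P w \<noteq> 0" "[:- f, 0, 1:] dvd w * (h * k - s * t)"
    using s by (auto simp: curve_frac_eq_iff)
  then show "eval_at P h \<noteq> 0"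
    using eval_at_curve_dvd[OF P] s t by fastforce
next
  assume h: "eval_at P h \<noteq> 0"
  have "curve_frac f P h s \<otimes>\<^bsub>local_ring f P\<^esub> curve_frac f P s h = \<one>\<^bsub>local_ring f P\<^esub>"
    using h s by (auto simp: curve_frac_simps one_local_ring curve_frac_eq_iff mult.commute
        intro!: exI[of _ 1])
  moreover have "curve_frac f P h s \<in> carrier (local_ring f P)"
    "curve_frac f P s h \<in> carrier (local_ring f P)"
    using h s by (auto simp: carrier_local_ring)
  ultimately show "curve_frac f P h s \<in> Units (local_ring f P)"
    by (metis L.Units_one_closed L.unit_factor)
qed

lemma curve_frac_in_max_ideal_iff:
  "eval_at P s \<noteq> 0 \<Longrightarrow> curve_frac f P h s \<in> max_ideal (local_ring f P) \<longleftrightarrow> eval_at P h = 0"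
  by (auto simp: max_ideal_def curve_frac_in_Units_iff) (auto simp: carrier_local_ring)

text \<open>The non-units are the fractions whose numerator vanishes at \<open>P\<close>, a
  condition preserved by sums and multiples. In other words, the ring is local.\<close>

lemma ideal_max_ideal: "ideal (max_ideal (local_ring f P)) (local_ring f P)"
proof -
  let ?L = "local_ring f P" and ?M = "max_ideal (local_ring f P)"
  have absorb: "r \<otimes>\<^bsub>?L\<^esub> x \<in> ?M" if "x \<in> ?M" "r \<in> carrier ?L" for x r
  proof -
    have "x \<in> carrier ?L" using that by (simp add: max_ideal_def)
    with that show ?thesis
      by (auto simp: carrier_local_ring curve_frac_simps curve_frac_in_max_ideal_iff)
  qed
  have add: "x \<oplus>\<^bsub>?L\<^esub> y \<in> ?M" if "x \<in> ?M" "y \<in> ?M" for x y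
  proof -
    have "x \<in> carrier ?L" "y \<in> carrier ?L" using that by (simp_all add: max_ideal_def)
    with that show ?thesis
      by (auto simp: carrier_local_ring curve_frac_simps curve_frac_in_max_ideal_iff)
  qed
  have carr: "?M \<subseteq> carrier ?L" by (auto simp: max_ideal_def)
  show ?thesis
  proof (rule idealI)
    show "subgroup ?M (add_monoid ?L)"
    proof (rule L.add.subgroupI)
      have "\<zero>\<^bsub>?L\<^esub> \<in> ?M" by (simp add: zero_local_ring curve_frac_in_max_ideal_iff)
      then show "?M \<noteq> {}" by blast
      fix x assume x: "x \<in> ?M"
      \<comment> \<open>Negation as a multiple, so that \<open>absorb\<close> covers it.\<close>
      then have "\<ominus>\<^bsub>?L\<^esub> x = (\<ominus>\<^bsub>?L\<^esub> \<one>\<^bsub>?L\<^esub>) \<otimes>\<^bsub>?L\<^esub> x"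
        using carr by (simp add: L.l_minus subsetD)
      then show "\<ominus>\<^bsub>?L\<^esub> x \<in> ?M"
        using absorb[OF x] by simp
    qed (use carr add in auto)
  next
    fix x r assume "x \<in> ?M" "r \<in> carrier ?L"
    then show "r \<otimes>\<^bsub>?L\<^esub> x \<in> ?M" "x \<otimes>\<^bsub>?L\<^esub> r \<in> ?M"
      using absorb[of x r] carr L.m_comm[of x r] by auto
  qed (rule L.ring_axioms)
qed

end


section \<open>Powers of the maximal ideal\<close>

lemma ideals_set_simps [simp]:
  "\<one>\<^bsub>ideals_set R\<^esub> = carrier R"
  "I \<otimes>\<^bsub>ideals_set R\<^esub> J = ideal_prod R I J"
  by (simp_all add: ideals_set_def)

lemma (in cring) ideal_pow_is_ideal:
  "ideal M R \<Longrightarrow> ideal (M [^]\<^bsub>ideals_set R\<^esub> (n::nat)) R"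
  by (induction n) (simp_all add: oneideal ideal_prod_is_ideal)

text \<open>A product of two ideals lies in their intersection, so each further factor
  \<open>M\<close> can only shrink the power.\<close>

lemma (in cring) ideal_pow_antimono:
  fixes m n :: nat
  assumes "ideal M R" "m \<le> n"
  shows "M [^]\<^bsub>ideals_set R\<^esub> n \<subseteq> M [^]\<^bsub>ideals_set R\<^esub> m"
proof -
  have "M [^]\<^bsub>ideals_set R\<^esub> Suc k \<subseteq> M [^]\<^bsub>ideals_set R\<^esub> k" for k
    using ideal_prod_inter[OF ideal_pow_is_ideal[OF assms(1), of k] assms(1)] by simp
  then show ?thesis
    using assms(2) by (rule lift_Suc_antimono_le)
qed

text \<open>Since the powers decrease, an element outside the n-th power lies only in powers with
  exponent below \<open>n\<close>, and the supremum stays below \<open>n\<close> as well.\<close>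

lemma (in cring) le_local_ord_iff:
  assumes "ideal (max_ideal R) R" "z \<in> carrier R"
  shows "enat n \<le> local_ord R z \<longleftrightarrow> z \<in> max_ideal R [^]\<^bsub>ideals_set R\<^esub> n"
proof
  show "enat n \<le> local_ord R z" if "z \<in> max_ideal R [^]\<^bsub>ideals_set R\<^esub> n"
    unfolding local_ord_def using that by (intro Sup_upper) blast
  assume le: "enat n \<le> local_ord R z"
  show "z \<in> max_ideal R [^]\<^bsub>ideals_set R\<^esub> n"
  proof (rule ccontr)
    assume z: "z \<notin> max_ideal R [^]\<^bsub>ideals_set R\<^esub> n"
    \<comment> \<open>The power with exponent 0 is the whole ring, so \<open>n\<close> is
      positive.\<close>
    then obtain k where n: "n = Suc k"
      using assms(2) by (cases n) auto
    have "m \<le> k" if "z \<in> max_ideal R [^]\<^bsub>ideals_set R\<^esub> m" for m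
      using that z n ideal_pow_antimono[OF assms(1), of n m] by (cases "m \<le> k") auto
    then have "local_ord R z \<le> enat k"
      unfolding local_ord_def by (intro Sup_least) auto
    with le n show False by (metis Suc_n_not_le_n enat_ord_simps(1) order_trans)
  qed
qed

text \<open>As \<open>p\<close> has order 0 at \<open>a\<close>, the orders of \<open>p * q\<close>
  and \<open>q\<close> there agree. Put differently, \<open>p\<close> is a unit modulo every power
  of x - a.\<close>

lemma linear_power_dvd_mult_cancel:
  fixes p q :: "'a::idom poly"
  assumes "poly p a \<noteq> 0" "[:- a, 1:] ^ n dvd p * q"
  shows "[:- a, 1:] ^ n dvd q"
proof (cases "q = 0")
  case False
  moreover have "p \<noteq> 0" using assms(1) by auto
  ultimately have "order a (p * q) = order a q"
    using assms(1) by (simp add: order_mult order_root)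
  with assms(2) \<open>p \<noteq> 0\<close> False show ?thesis
    by (auto simp: order_divides)
qed simp

text \<open>Identifies evaluation at the point (a, v(a)) with substituting \<open>v\<close> for y
  and then taking the value at \<open>a\<close>.\<close>

lemma poly_poly_const: "poly (poly h [:poly v a:]) a = poly (poly h v) a"
  for v :: "'a::comm_ring_1 poly"
  by (induction h) auto

text \<open>The substitution turns y^2 - f into v^2 - f, hence it is well defined from the
  coordinate ring to the residues modulo \<open>p\<close>.\<close>

lemma curve_eval_dvd:
  fixes f p v :: "'a::comm_ring_1"
  assumes "[:- f, 0, 1:] dvd h" "p dvd v\<^sup>2 - f"
  shows "p dvd poly h v"
proof -
  from assms(1) obtain k where "h = [:- f, 0, 1:] * k" ..
  then have "poly h v = poly [:- f, 0, 1:] v * poly k v"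
    by (simp only: poly_mult)
  also have "poly [:- f, 0, 1:] v = v\<^sup>2 - f"
    by (simp add: power2_eq_square algebra_simps)
  finally have "poly h v = (v\<^sup>2 - f) * poly k v" .
  with assms(2) show ?thesis by simp
qed

text \<open>Induction on the exponent, and inside it on the generation of a product of ideals. The
  bound \<open>n \<le> e\<close> enters because \<open>v\<close> is known to satisfy the curve
  equation only modulo (x - a)^e.\<close>

lemma max_ideal_pow_imp_dvd:
  fixes f v :: "'a::field poly"
  assumes P: "P \<in> affine_points f" and P_def: "P = Affine a (poly v a)"
    and v: "[:- a, 1:] ^ e dvd v\<^sup>2 - f"
    and le: "n \<le> e"
    and mem: "curve_frac f P h s \<in> max_ideal (local_ring f P) [^]\<^bsub>ideals_set (local_ring f P)\<^esub> n"
    and s: "eval_at P s \<noteq> 0"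
  shows "[:- a, 1:] ^ n dvd poly h v"
proof -
  interpret L: cring "local_ring f P" using P by (rule local_ring_cring)
  let ?pow = "\<lambda>n::nat. max_ideal (local_ring f P) [^]\<^bsub>ideals_set (local_ring f P)\<^esub> n"
  have pow_carrier: "z \<in> carrier (local_ring f P)" if "z \<in> ?pow n" for n z
    by (rule ideal.Icarr[OF L.ideal_pow_is_ideal[OF ideal_max_ideal[OF P]] that])
  have eval_at: "eval_at P h = poly (poly h v) a" for h
    by (simp add: P_def eval_at_def poly_poly_const)
  \<comment> \<open>The divisibility does not depend on the fraction chosen for an element: after
    substitution, the denominator and the factor \<open>w\<close> do not vanish at \<open>a\<close>
    and cancel.\<close>
  have indep: "[:- a, 1:] ^ n dvd poly h v"
    if hyps: "n \<le> e" "curve_frac f P h s = curve_frac f P k t" "eval_at P s \<noteq> 0" "eval_at P t \<noteq> 0"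
      "[:- a, 1:] ^ n dvd poly k v" for n h s k t
  proof -
    obtain w where w: "eval_at P w \<noteq> 0" "[:- f, 0, 1:] dvd w * (t * h - s * k)"
      using curve_frac_eq_iff[OF P hyps(3,4)] hyps(2) by blast
    have "[:- a, 1:] ^ n dvd v\<^sup>2 - f"
      using le_imp_power_dvd[OF hyps(1)] v dvd_trans by blast
    from curve_eval_dvd[OF w(2) this]
    have "[:- a, 1:] ^ n dvd poly w v * (poly t v * poly h v - poly s v * poly k v)"
      by simp
    with w(1) have "[:- a, 1:] ^ n dvd poly t v * poly h v - poly s v * poly k v"
      unfolding eval_at by (rule linear_power_dvd_mult_cancel)
    from dvd_add[OF this dvd_mult[OF hyps(5), of "poly s v"]]
    have "[:- a, 1:] ^ n dvd poly t v * poly h v"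
      by simp
    with hyps(4) show ?thesis
      unfolding eval_at by (rule linear_power_dvd_mult_cancel)
  qed
  \<comment> \<open>Quantifying over all fractions for \<open>z\<close> lets the induction
    hypotheses apply to whichever fractions are picked for factors and summands.\<close>
  have "\<forall>h s. z = curve_frac f P h s \<longrightarrow> eval_at P s \<noteq> 0 \<longrightarrow> [:- a, 1:] ^ n dvd poly h v"
    if "z \<in> ?pow n" for z
    using le that
  proof (induction n arbitrary: z)
    case 0
    then show ?case by simp
  next
    case (Suc n)
    from Suc.prems(2) show ?case
      unfolding nat_pow_Suc ideals_set_simps
    proof (induction rule: ideal_prod.induct)
      case (prod i j)
      have "j \<in> carrier (local_ring f P)"
        using prod(2) by (simp add: max_ideal_def)
      with pow_carrier[OF prod(1)] obtain h1 s1 h2 s2 where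
        i: "i = curve_frac f P h1 s1" "eval_at P s1 \<noteq> 0" and
        j: "j = curve_frac f P h2 s2" "eval_at P s2 \<noteq> 0"
        by (auto simp: carrier_local_ring[OF P])
      have "[:- a, 1:] ^ n dvd poly h1 v"
        using Suc.IH[OF _ prod(1)] Suc.prems(1) i by simp
      \<comment> \<open>The factor from the maximal ideal has a numerator vanishing at
        \<open>P\<close>, so it contributes one more factor x - a.\<close>
      moreover have "[:- a, 1:] dvd poly h2 v"
        using prod(2) j by (simp add: curve_frac_in_max_ideal_iff[OF P] eval_at poly_eq_0_iff_dvd)
      ultimately have "[:- a, 1:] ^ Suc n dvd poly (h1 * h2) v"
        unfolding poly_mult power_Suc2 by (rule mult_dvd_mono)
      then show ?case
        using indep[OF Suc.prems(1), of _ _ "h1 * h2" "s1 * s2"] i j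
        by (simp add: curve_frac_simps[OF P])
    next
      case (sum z1 z2)
      have "ideal (ideal_prod (local_ring f P) (?pow n) (max_ideal (local_ring f P))) (local_ring f P)"
        using L.ideal_pow_is_ideal[OF ideal_max_ideal[OF P], of "Suc n"] by simp
      then have "z1 \<in> carrier (local_ring f P)" "z2 \<in> carrier (local_ring f P)"
        using sum(1,2) by (simp_all add: ideal.Icarr)
      then obtain h1 s1 h2 s2 where
        z1: "z1 = curve_frac f P h1 s1" "eval_at P s1 \<noteq> 0" and
        z2: "z2 = curve_frac f P h2 s2" "eval_at P s2 \<noteq> 0"
        by (auto simp: carrier_local_ring[OF P])
      have "[:- a, 1:] ^ Suc n dvd poly (s2 * h1 + s1 * h2) v"
        using sum.IH z1 z2 by (simp del: power_Suc)
      then show ?case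
        using indep[OF Suc.prems(1), of _ _ "s2 * h1 + s1 * h2" "s1 * s2"] z1 z2
        by (simp add: curve_frac_simps[OF P] del: power_Suc)
    qed
  qed
  from this[OF mem] s show ?thesis by blast
qed

section \<open>Order conditions on polynomials\<close>

lemma le_ord_at_iff:
  assumes P: "P \<in> affine_points f"
  shows "enat n \<le> ord_at f P (coord_class f h) \<longleftrightarrow>
    curve_frac f P h 1 \<in> max_ideal (local_ring f P) [^]\<^bsub>ideals_set (local_ring f P)\<^esub> n"
proof -
  interpret L: cring "local_ring f P" using P by (rule local_ring_cring)
  have "curve_frac f P h 1 \<in> carrier (local_ring f P)"
    unfolding carrier_local_ring[OF P] using eval_at_simps(2)[of P] zero_neq_one by fastforce
  then show ?thesis
    using L.le_local_ord_iff[OF ideal_max_ideal[OF P]]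
    by (simp add: ord_at_def curve_frac_def coord_class_simps)
qed

text \<open>The set is the preimage of a power of the maximal ideal under the homomorphism that
  sends h to the fraction h/1.\<close>

lemma ideal_le_ord_at:
  assumes P: "P \<in> affine_points f"
  shows "ideal {h. enat n \<le> ord_at f P (coord_class f h)} xy_ring"
proof -
  interpret L: cring "local_ring f P" using P by (rule local_ring_cring)
  let ?I = "max_ideal (local_ring f P) [^]\<^bsub>ideals_set (local_ring f P)\<^esub> n"
  interpret I: ideal ?I "local_ring f P"
    using L.ideal_pow_is_ideal[OF ideal_max_ideal[OF P]] .
  have add: "curve_frac f P (h + k) 1 = curve_frac f P h 1 \<oplus>\<^bsub>local_ring f P\<^esub> curve_frac f P k 1" for h k
    by (simp add: curve_frac_simps[OF P])
  have mult: "curve_frac f P (h * k) 1 = curve_frac f P h 1 \<otimes>\<^bsub>local_ring f P\<^esub> curve_frac f P k 1" for h k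
    by (simp add: curve_frac_simps[OF P])
  have "curve_frac f P h 1 \<in> carrier (local_ring f P)" for h
    unfolding carrier_local_ring[OF P] using eval_at_simps(2)[of P] zero_neq_one by fastforce
  then show ?thesis
    using I.zero_closed
    by (simp add: ideal_ring_of_type_algebra_iff le_ord_at_iff[OF P] add mult I.I_l_closed
        zero_local_ring[OF P])
qed

lemma one_le_ord_at_iff:
  assumes P: "P \<in> affine_points f"
  shows "enat 1 \<le> ord_at f P (coord_class f h) \<longleftrightarrow> eval_at P h = 0"
proof -
  interpret L: cring "local_ring f P" using P by (rule local_ring_cring)
  note M = ideal_max_ideal[OF P]
  \<comment> \<open>The first power unfolds to the product of the whole ring with the maximal
    ideal.\<close>
  have "max_ideal (local_ring f P) [^]\<^bsub>ideals_set (local_ring f P)\<^esub> (1::nat) = max_ideal (local_ring f P)"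
    using L.ideal_prod_commute[OF M L.oneideal] L.ideal_prod_one[OF M]
    by simp
  then show ?thesis
    using curve_frac_in_max_ideal_iff[OF P, of 1 h] by (simp add: le_ord_at_iff[OF P] del: One_nat_def)
qed

text \<open>Applied with h = x - a, this handles the factor of \<open>u\<close> that belongs to
  \<open>P\<close>.\<close>

lemma le_ord_at_power:
  assumes P: "P \<in> affine_points f" and h: "eval_at P h = 0"
  shows "enat n \<le> ord_at f P (coord_class f (h ^ n))"
proof -
  have "curve_frac f P (h ^ n) 1 \<in> max_ideal (local_ring f P) [^]\<^bsub>ideals_set (local_ring f P)\<^esub> n"
  proof (induction n)
    case 0
    show ?case
      by (auto simp: carrier_local_ring[OF P] intro!: exI[of _ 1])
  next
    case (Suc n)
    have "curve_frac f P h 1 \<in> max_ideal (local_ring f P)"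
      using h curve_frac_in_max_ideal_iff[OF P] by simp
    from ideal_prod.prod[OF Suc this, of "local_ring f P"] show ?case
      by (simp add: curve_frac_simps[OF P] mult.commute)
  qed
  then show ?thesis by (simp add: le_ord_at_iff[OF P])
qed


section \<open>The ideal of a divisor\<close>

lemma eval_at_linear: "eval_at P [:- v, 1:] = ycoord P - poly v (xcoord P)"
  "eval_at P [:p:] = poly p (xcoord P)"
  by (simp_all add: eval_at_def)

text \<open>The roots are distinct, so the product over the earlier indices does not vanish at the
  next root and can be cancelled; the new prime power divides the cofactor.\<close>

lemma prod_linear_powers_dvd:
  fixes p :: "'a::idom poly"
  assumes "finite A" "inj_on c A" "\<And>i. i \<in> A \<Longrightarrow> [:- c i, 1:] ^ e i dvd p"
  shows "(\<Prod>i\<in>A. [:- c i, 1:] ^ e i) dvd p"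
  using assms
proof (induction A rule: finite_induct)
  case (insert i A)
  then obtain q where q: "p = (\<Prod>i\<in>A. [:- c i, 1:] ^ e i) * q"
    by (auto simp: dvd_def)
  have "poly (\<Prod>i\<in>A. [:- c i, 1:] ^ e i) (c i) \<noteq> 0"
    using insert by (auto simp: poly_prod poly_power inj_on_def)
  then have "[:- c i, 1:] ^ e i dvd q"
    using insert.prems(2)[of i] q linear_power_dvd_mult_cancel by blast
  then have "[:- c i, 1:] ^ e i * (\<Prod>i\<in>A. [:- c i, 1:] ^ e i) dvd p"
    unfolding q by (subst mult.commute) (intro mult_dvd_mono dvd_refl)
  with insert.hyps show ?case by simp
qed simp

text \<open>Modulo y - v every h equals its remainder \<open>poly h v\<close>, which involves x
  alone. Membership becomes a divisibility in one variable.\<close>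

lemma Idl_graph:
  fixes u v :: "'a::field poly"
  shows "Idl\<^bsub>xy_ring\<^esub> {[:u:], [:- v, 1:]} = {h. u dvd poly h v}" (is "?J = _")
proof -
  interpret cring "xy_ring :: 'a poly poly ring" by (rule cring_from_type_algebra)
  have J: "ideal ?J xy_ring" by (rule genideal_ideal) simp
  have gen: "[:u:] \<in> ?J" "[:- v, 1:] \<in> ?J"
    using genideal_self[of "{[:u:], [:- v, 1:]}"] by simp_all
  show ?thesis
  proof
    have "ideal {h. u dvd poly h v} xy_ring"
      by (simp add: ideal_ring_of_type_algebra_iff)
    then show "?J \<subseteq> {h. u dvd poly h v}"
      by (rule genideal_minimal) simp
    show "{h. u dvd poly h v} \<subseteq> ?J"
    proof clarify
      fix h assume "u dvd poly h v"
      then obtain k where k: "poly h v = k * u"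
        by (auto simp: dvd_def mult.commute)
      \<comment> \<open>Factor theorem over the coefficient ring K[x]: subtracting the remainder
        makes \<open>v\<close> a root.\<close>
      have "poly (h - [:poly h v:]) v = 0" by simp
      then have "[:- v, 1:] dvd h - [:poly h v:]"
        by (simp only: poly_eq_0_iff_dvd)
      then obtain q where "h - [:poly h v:] = [:- v, 1:] * q" ..
      then have "h = q * [:- v, 1:] + [:k:] * [:u:]"
        using k by (simp add: algebra_simps)
      with gen show "h \<in> ?J"
        using J unfolding ideal_ring_of_type_algebra_iff by blast
    qed
  qed
qed

text \<open>Points of the curve with equal x-coordinates are equal or exchanged by the involution,
  and a semi-reduced divisor never contains both of two distinct conjugate points.\<close>

lemma semi_reduced_inj_on_xcoord:
  assumes "semi_reduced f d"
  shows "inj_on xcoord (Poly_Mapping.keys d)"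
proof (rule inj_onI)
  fix P Q assume PQ: "P \<in> Poly_Mapping.keys d" "Q \<in> Poly_Mapping.keys d" "xcoord P = xcoord Q"
  then have "P \<in> affine_points f" "Q \<in> affine_points f"
    using assms by (auto simp: semi_reduced_def)
  with PQ(3) obtain a b b' where P: "P = Affine a b" and Q: "Q = Affine a b'" and "b\<^sup>2 = b'\<^sup>2"
    by (auto simp: affine_points_def)
  then have "Q = P \<or> Q = hyp_inv P"
    by (auto simp: power2_eq_iff)
  moreover have "0 < Poly_Mapping.lookup d P"
    using PQ(1) assms by (simp add: semi_reduced_def effective_def in_keys_iff order_less_le)
  ultimately show "P = Q"
    using PQ(2) assms by (auto simp: semi_reduced_def in_keys_iff)
qed

lemma mumford_rep_dvd: "mumford_rep f d u v \<Longrightarrow> u dvd v\<^sup>2 - f"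
  by (auto simp: mumford_rep_def split: if_splits)

lemma mumford_rep_monic: "mumford_rep f d u v \<Longrightarrow> Polynomial.lead_coeff u = 1"
  by (auto simp: mumford_rep_def lead_coeff_prod lead_coeff_power split: if_splits)

lemma div_ideal_lift_eq:
  assumes semi: "semi_reduced f d" and mum: "mumford_rep f d u v"
  shows "div_ideal_lift f d = Idl\<^bsub>xy_ring\<^esub> {[:u:], [:- v, 1:]}"
\<comment> \<open>For the zero divisor there is no order condition and \<open>u = 1\<close>, so both
  sides are the whole ring.\<close>
proof (cases "d = 0")
  case True
  with mum have "u = 1" by (simp add: mumford_rep_def)
  with True show ?thesis
    by (simp add: Idl_graph div_ideal_lift_def div_ideal_def)
next
  case False
  let ?e = "\<lambda>P. nat (Poly_Mapping.lookup d P)"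
  let ?l = "\<lambda>P. [:- xcoord P, 1:]"
  have u: "u = (\<Prod>P\<in>Poly_Mapping.keys d. ?l P ^ ?e P)"
    and v: "\<And>P. P \<in> Poly_Mapping.keys d \<Longrightarrow> enat (?e P) \<le> ord_at f P (coord_class f [:- v, 1:])"
    using mum False by (auto simp: mumford_rep_def)
  have l_dvd_u: "?l P ^ ?e P dvd u" if "P \<in> Poly_Mapping.keys d" for P
    unfolding u using that by (intro dvd_prodI) auto
  have affine: "P \<in> affine_points f" if "P \<in> Poly_Mapping.keys d" for P
    using that semi by (auto simp: semi_reduced_def)
  have lift_iff: "h \<in> div_ideal_lift f d \<longleftrightarrow>
      (\<forall>P\<in>Poly_Mapping.keys d. enat (?e P) \<le> ord_at f P (coord_class f h))" for h
    by (simp add: div_ideal_lift_def div_ideal_def)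
  show ?thesis
  proof
    show "div_ideal_lift f d \<subseteq> Idl\<^bsub>xy_ring\<^esub> {[:u:], [:- v, 1:]}"
    proof
      fix h assume h: "h \<in> div_ideal_lift f d"
      have "?l P ^ ?e P dvd poly h v" if P: "P \<in> Poly_Mapping.keys d" for P
      proof (rule max_ideal_pow_imp_dvd[OF affine[OF P]])
        have "0 < Poly_Mapping.lookup d P"
          using P semi by (simp add: semi_reduced_def effective_def in_keys_iff order_less_le)
        \<comment> \<open>Multiplicities in the support are at least 1, so the order condition on y
          - v makes it vanish at \<open>P\<close>; this shows that \<open>P\<close> lies on the
          graph of \<open>v\<close>.\<close>
        then have "enat 1 \<le> enat (?e P)" by simp
        also note v[OF P]
        finally have "eval_at P [:- v, 1:] = 0"
          by (simp only: one_le_ord_at_iff[OF affine[OF P]])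
        then show "P = Affine (xcoord P) (poly v (xcoord P))"
          using affine[OF P] by (auto simp: affine_points_def eval_at_linear)
        show "?l P ^ ?e P dvd v\<^sup>2 - f"
          using l_dvd_u[OF P] mumford_rep_dvd[OF mum] by (rule dvd_trans)
        show "curve_frac f P h 1 \<in> max_ideal (local_ring f P) [^]\<^bsub>ideals_set (local_ring f P)\<^esub> ?e P"
          using h P by (simp add: lift_iff flip: le_ord_at_iff[OF affine[OF P]])
      qed simp_all
      then have "u dvd poly h v"
        unfolding u using semi_reduced_inj_on_xcoord[OF semi]
        by (intro prod_linear_powers_dvd) simp_all
      then show "h \<in> Idl\<^bsub>xy_ring\<^esub> {[:u:], [:- v, 1:]}"
        by (simp add: Idl_graph)
    qed
    show "Idl\<^bsub>xy_ring\<^esub> {[:u:], [:- v, 1:]} \<subseteq> div_ideal_lift f d"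
    proof
      fix h assume h: "h \<in> Idl\<^bsub>xy_ring\<^esub> {[:u:], [:- v, 1:]}"
      have "enat (?e P) \<le> ord_at f P (coord_class f h)" if P: "P \<in> Poly_Mapping.keys d" for P
      proof -
        interpret ring xy_ring by (rule ring_from_type_algebra)
        \<comment> \<open>As the order condition at \<open>P\<close> defines an ideal, it suffices
          to check the two generators: y - v satisfies it by the Mumford conditions, and
          \<open>u\<close> is a multiple of (x - a)^e.\<close>
        let ?J = "{h. enat (?e P) \<le> ord_at f P (coord_class f h)}"
        have J: "ideal ?J xy_ring" by (rule ideal_le_ord_at[OF affine[OF P]])
        from l_dvd_u[OF P] obtain k where "u = ?l P ^ ?e P * k" ..
        then have "[:u:] = [:k:] * [:?l P:] ^ ?e P"
          by (simp add: poly_const_pow mult.commute)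
        moreover have "[:?l P:] ^ ?e P \<in> ?J"
          using le_ord_at_power[OF affine[OF P], of "[:?l P:]"] by (simp add: eval_at_linear)
        ultimately have "[:u:] \<in> ?J"
          using J unfolding ideal_ring_of_type_algebra_iff by metis
        with v[OF P] have "Idl\<^bsub>xy_ring\<^esub> {[:u:], [:- v, 1:]} \<subseteq> ?J"
          by (intro genideal_minimal[OF J]) simp
        with h show ?thesis by blast
      qed
      then show "h \<in> div_ideal_lift f d" by (simp add: lift_iff)
    qed
  qed
qed


section \<open>Groebner bases\<close>

lemma lex_y_gt_x_antisym: "\<lbrakk>lex_y_gt_x m m'; lex_y_gt_x m' m\<rbrakk> \<Longrightarrow> m = m'"
  by (auto simp: lex_y_gt_x_def prod_eq_iff)

text \<open>Since y dominates, the degree in y decides first, and ties are decided by the degree in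
  x of the coefficient. The nested representation provides both numbers directly.\<close>

lemma lead_mono_lex:
  assumes "p \<noteq> 0"
  shows "lead_mono lex_y_gt_x p
    = (Polynomial.degree (Polynomial.lead_coeff p), Polynomial.degree p)"
  unfolding lead_mono_def
proof (rule the_equality)
  show *: "(Polynomial.degree (Polynomial.lead_coeff p), Polynomial.degree p) \<in> monos2 p \<and>
    (\<forall>m'\<in>monos2 p. lex_y_gt_x m' (Polynomial.degree (Polynomial.lead_coeff p), Polynomial.degree p))"
  proof (intro conjI ballI)
    fix m' assume "m' \<in> monos2 p"
    then have *: "Polynomial.coeff (Polynomial.coeff p (snd m')) (fst m') \<noteq> 0"
      by (simp add: monos2_def coeff2_def)
    then have "Polynomial.coeff p (snd m') \<noteq> 0" by auto
    then have "snd m' \<le> Polynomial.degree p" by (rule le_degree)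
    moreover have "fst m' \<le> Polynomial.degree (Polynomial.coeff p (snd m'))"
      using * by (rule le_degree)
    ultimately show
      "lex_y_gt_x m' (Polynomial.degree (Polynomial.lead_coeff p), Polynomial.degree p)"
      by (auto simp: lex_y_gt_x_def)
  qed (use assms in \<open>simp add: monos2_def coeff2_def\<close>)
  fix m assume "m \<in> monos2 p \<and> (\<forall>m'\<in>monos2 p. lex_y_gt_x m' m)"
  with * show "m = (Polynomial.degree (Polynomial.lead_coeff p), Polynomial.degree p)"
    by (intro lex_y_gt_x_antisym) simp_all
qed

lemma lead_coeff2_lex:
  "p \<noteq> 0 \<Longrightarrow> lead_coeff2 lex_y_gt_x p = Polynomial.lead_coeff (Polynomial.lead_coeff p)"
  by (simp add: lead_coeff2_def lead_mono_lex coeff2_def)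

lemma lead_term_lex:
  "p \<noteq> 0 \<Longrightarrow> lead_term lex_y_gt_x p
    = Polynomial.monom (Polynomial.monom (Polynomial.lead_coeff (Polynomial.lead_coeff p))
        (Polynomial.degree (Polynomial.lead_coeff p))) (Polynomial.degree p)"
  by (simp add: lead_term_def monom2_def lead_coeff2_lex lead_mono_lex)

text \<open>Because y is larger than every power of x, the leading term of y - v is y whatever the
  degree of \<open>v\<close>.\<close>

lemma lead_term_generators:
  assumes "Polynomial.lead_coeff u = 1"
  shows "lead_term lex_y_gt_x [:u:] = [:Polynomial.monom 1 (Polynomial.degree u):]"
    and "lead_term lex_y_gt_x [:- v, 1:] = Polynomial.monom 1 1"
proof -
  have "u \<noteq> 0" using assms by auto
  with assms show "lead_term lex_y_gt_x [:u:] = [:Polynomial.monom 1 (Polynomial.degree u):]"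
    by (simp add: lead_term_lex monom_0)
  show "lead_term lex_y_gt_x [:- v, 1:] = Polynomial.monom 1 1"
    by (simp add: lead_term_lex monom_0)
qed

text \<open>An element of the ideal free of y is a multiple of \<open>u\<close>, so its leading term
  is a multiple of x^(deg u). Any other element has a leading term divisible by y.\<close>

lemma groebner_basis_graph:
  fixes u v :: "'a::field poly"
  assumes monic: "Polynomial.lead_coeff u = 1"
  shows "groebner_basis lex_y_gt_x (Idl\<^bsub>xy_ring\<^esub> {[:u:], [:- v, 1:]}) {[:u:], [:- v, 1:]}"
proof -
  interpret cring "xy_ring :: 'a poly poly ring" by (rule cring_from_type_algebra)
  let ?G = "{[:u:], [:- v, 1:]}"
  let ?I = "Idl\<^bsub>xy_ring\<^esub> ?G"
  let ?J = "Idl\<^bsub>xy_ring\<^esub> (lead_term lex_y_gt_x ` ?G)"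
  have G: "?G \<subseteq> ?I" by (rule genideal_self) simp
  have "u \<noteq> 0" using monic by auto
  then have G0: "0 \<notin> ?G" by simp
  have J: "ideal ?J xy_ring" by (rule genideal_ideal) simp
  have "lead_term lex_y_gt_x ` ?G \<subseteq> ?J" by (rule genideal_self) simp
  then have gen: "[:Polynomial.monom 1 (Polynomial.degree u):] \<in> ?J" "Polynomial.monom 1 1 \<in> ?J"
    by (simp_all add: lead_term_generators[OF monic])
  have "lead_term lex_y_gt_x p \<in> ?J" if "p \<in> ?I" "p \<noteq> 0" for p
  proof (cases "Polynomial.degree p")
    case 0
    then obtain r where r: "p = [:r:]" by (rule degree_eq_zeroE)
    with that have "u dvd r" "r \<noteq> 0" by (simp_all add: Idl_graph)
    then have "Polynomial.degree u \<le> Polynomial.degree r" by (rule dvd_imp_degree_le)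
    then have "lead_term lex_y_gt_x p
        = [:Polynomial.monom (Polynomial.lead_coeff r) (Polynomial.degree r - Polynomial.degree u):]
          * [:Polynomial.monom 1 (Polynomial.degree u):]"
      using r \<open>r \<noteq> 0\<close> by (simp add: lead_term_lex monom_0 mult_monom)
    with gen(1) J show ?thesis
      unfolding ideal_ring_of_type_algebra_iff by metis
  next
    case (Suc j)
    then have "lead_term lex_y_gt_x p
        = Polynomial.monom (Polynomial.monom (Polynomial.lead_coeff (Polynomial.lead_coeff p))
            (Polynomial.degree (Polynomial.lead_coeff p))) j * Polynomial.monom 1 1"
      using that by (simp add: lead_term_lex mult_monom)
    with gen(2) J show ?thesis
      unfolding ideal_ring_of_type_algebra_iff by metis
  qed
  then have "Idl\<^bsub>xy_ring\<^esub> (lead_term lex_y_gt_x ` (?I - {0})) \<subseteq> ?J"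
    by (intro genideal_minimal[OF J]) auto
  moreover have "?J \<subseteq> Idl\<^bsub>xy_ring\<^esub> (lead_term lex_y_gt_x ` (?I - {0}))"
    using G G0 by (intro subset_Idl_subset) auto
  ultimately show ?thesis
    unfolding groebner_basis_def using G G0 genideal_ideal[of ?G] by simp
qed

text \<open>The monomials of \<open>u\<close> are powers of x, hence not divisible by y. Those of y
  - v are y and powers of x below x^(deg u), hence not divisible by x^(deg u).\<close>

lemma reduced_groebner_basis_graph:
  fixes u v :: "'a::field poly"
  assumes monic: "Polynomial.lead_coeff u = 1"
    and deg: "Polynomial.degree v < Polynomial.degree u"
  shows "reduced_groebner_basis lex_y_gt_x (Idl\<^bsub>xy_ring\<^esub> {[:u:], [:- v, 1:]}) {[:u:], [:- v, 1:]}"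
proof -
  have "u \<noteq> 0" using monic by auto
  have minus: "{[:u:], [:- v, 1:]} - {[:u:]} = {[:- v, 1:]}"
    "{[:u:], [:- v, 1:]} - {[:- v, 1:]} = {[:u:]}" by auto
  have "monom2 1 m \<notin> Idl\<^bsub>xy_ring\<^esub> {lead_term lex_y_gt_x [:- v, 1:]}" if "m \<in> monos2 [:u:]" for m
  proof -
    from that have "snd m = 0"
      by (cases "snd m") (auto simp: monos2_def coeff2_def coeff_pCons)
    \<comment> \<open>Setting y = 0 preserves a power of x but kills every multiple of y.\<close>
    then have "poly (monom2 1 m) 0 \<noteq> (0 :: 'a poly)"
      by (simp add: monom2_def monom_0)
    then show ?thesis
      by (auto simp: Idl_singleton lead_term_generators[OF monic] dvd_def poly_monom)
  qed
  moreover have "monom2 1 m \<notin> Idl\<^bsub>xy_ring\<^esub> {lead_term lex_y_gt_x [:u:]}"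
    if "m \<in> monos2 [:- v, 1:]" for m
  proof -
    obtain i j where m: "m = (i, j)" by (cases m)
    with that have coeff: "Polynomial.coeff (Polynomial.coeff [:- v, 1:] j) i \<noteq> 0"
      by (simp add: monos2_def coeff2_def)
    have "i < Polynomial.degree u"
    proof (cases j)
      case 0
      with coeff have "i \<le> Polynomial.degree v" by (simp add: le_degree)
      with deg show ?thesis by simp
    next
      \<comment> \<open>The only monomial of y - v involving y is y itself, with x-exponent 0; the
        degree bound makes deg u positive.\<close>
      case (Suc k)
      with coeff have "i = 0" by (auto simp: coeff_pCons split: nat.splits if_splits)
      with deg show ?thesis by simp
    qed
    then have "\<not> Polynomial.monom 1 (Polynomial.degree u) dvd (Polynomial.monom 1 i :: 'a poly)"
      by (auto dest!: dvd_imp_degree_le simp: degree_monom_eq)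
    \<comment> \<open>Divisibility by a polynomial constant in y is tested coefficientwise; the
      coefficient of y^j violates it.\<close>
    then show ?thesis
      by (auto simp: Idl_singleton lead_term_generators[OF monic] monom2_def m const_poly_dvd_iff
          split: if_splits dest!: spec[of _ j])
  qed
  ultimately show ?thesis
    unfolding reduced_groebner_basis_def using groebner_basis_graph[OF monic] \<open>u \<noteq> 0\<close> monic
    by (simp add: minus lead_coeff2_lex)
qed

text \<open>For d = 0 the set is {1, y}. It is a Groebner basis of the whole ring, but y is a
  multiple of the leading term 1, so it is not reduced; this is why reducedness is claimed for
  non-zero \<open>d\<close>.\<close>

theorem proposition2p1:
  fixes f :: "'k::field poly"
    and F u v :: "'k alg_closure poly"
    and g :: nat
    and d :: "'k alg_closure hpoint \<Rightarrow>\<^sub>0 int"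
  assumes "CHAR('k) \<noteq> 2"
    and "g \<ge> 1"
    and "Polynomial.degree f = 2 * g + 1"
    and "Polynomial.lead_coeff f = 1"
    and "F = map_poly to_ac f"
    and "rsquarefree F"
    and "semi_reduced F d"
    and "mumford_rep F d u v"
  shows "div_ideal_lift F d = Idl\<^bsub>xy_ring\<^esub> {[:u:], [:- v, 1:]}
    \<and> v\<^sup>2 - F \<in> Idl\<^bsub>x_ring\<^esub> {u}
    \<and> groebner_basis lex_y_gt_x (div_ideal_lift F d) {[:u:], [:- v, 1:]}
    \<and> (d \<noteq> 0 \<longrightarrow>
         reduced_groebner_basis lex_y_gt_x (div_ideal_lift F d) {[:u:], [:- v, 1:]})"
proof -
  note semi = \<open>semi_reduced F d\<close> and mum = \<open>mumford_rep F d u v\<close>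
  have "v\<^sup>2 - F \<in> Idl\<^bsub>x_ring\<^esub> {u}"
    using mumford_rep_dvd[OF mum] by (simp add: Idl_singleton)
  \<comment> \<open>For the zero divisor both degrees are 0 and the strict inequality fails.\<close>
  moreover have "Polynomial.degree v < Polynomial.degree u" if "d \<noteq> 0"
    using mum unfolding mumford_rep_def if_not_P[OF that] by (elim conjE)
  ultimately show ?thesis
    unfolding div_ideal_lift_eq[OF semi mum]
    by (intro conjI impI refl groebner_basis_graph reduced_groebner_basis_graph
        mumford_rep_monic[OF mum])
qed

end
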